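(* Let $M_G$ be a mixed graph with $n$ vertices and let $\alpha\in[0,1]$. Let $\mu_1(A_\alpha)\ge\mu_2(A_\alpha)\ge\dots\ge\mu_n(A_\alpha)$ be the eigenvalues of the matrix $A_\alpha$ of $M_G$, and let $\rho(A_\alpha)$ be its spectral radius. Then $$\frac12\,\rho(A_\alpha)\le\mu_1(A_\alpha)\le\rho(A_\alpha).$$
   Context: A mixed graph $M_G=(V,E,A)$ consists of a vertex set $V=\{v_1,\dots,v_n\}$, a set $E$ of undirected edges and a set $A$ of directed edges (arcs). All mixed graphs are finite and simple (no loops, no multiple edges or arcs), so any two distinct vertices are joined by at most one undirected edge or arc. The underlying graph $G$ is the simple undirected graph obtained by forgetting the directions of the arcs. The degree $d_i$ of $v_i$ is its degree in $G$, and $D=\mathrm{diag}(d_1,\dots,d_n)$. Let $\omega=\frac{1+i\sqrt3}{2}$. The Hermitian adjacency matrix of the second kind $H^\omega$ is the $n\times n$ matrix with $(v,u)$ entry equal to $\omega$ if there is an arc from $v$ to $u$, $\bar\omega$ if there is an arc from $u$ to $v$, $1$ if $\{v,u\}$ is an undirected edge, and $0$ otherwise. For $\alpha\in[0,1]$, $A_\alpha=\alpha D+(1-\alpha)H^\omega$, a Hermitian matrix, whose eigenvalues are real. The spectral radius $\rho$ of a matrix is the maximum of the absolute values of its eigenvalues. *)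

theory Defs
  imports
    "Jordan_Normal_Form.Spectral_Radius"
    "HOL-Computational_Algebra.Fundamental_Theorem_Algebra"
begin

text \<open>An undirected edge is a two-element set of vertices; the pair \<open>(u, v)\<close> is the arc from
  \<open>u\<close> to \<open>v\<close>. The last two axioms say that no pair of vertices carries two opposite arcs, or
  both an arc and an undirected edge.\<close>

locale mixed_graph =
  fixes V :: "'a set" and E :: "'a set set" and A :: "('a \<times> 'a) set"
  assumes finite_vertices: "finite V"
    and edges: "e \<in> E \<Longrightarrow> \<exists>u\<in>V. \<exists>v\<in>V. u \<noteq> v \<and> e = {u, v}"
    and arcs: "(u, v) \<in> A \<Longrightarrow> u \<in> V \<and> v \<in> V \<and> u \<noteq> v"
    and no_opposite_arcs: "(u, v) \<in> A \<Longrightarrow> (v, u) \<notin> A"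
    and no_edge_and_arc: "(u, v) \<in> A \<Longrightarrow> {u, v} \<notin> E"

definition underlying_edges :: "'a set set \<Rightarrow> ('a \<times> 'a) set \<Rightarrow> 'a set set" where
  "underlying_edges E A = E \<union> {{u, v} | u v. (u, v) \<in> A}"

definition mixed_degree :: "'a set set \<Rightarrow> ('a \<times> 'a) set \<Rightarrow> 'a \<Rightarrow> nat" where
  "mixed_degree E A v = card {e \<in> underlying_edges E A. v \<in> e}"

definition omega :: complex where
  "omega = (1 + \<i> * complex_of_real (sqrt 3)) / 2"

text \<open>The matrices are taken with respect to an enumeration \<open>vs\<close> of the vertex set. Matrix
  indices start at 0, so index \<open>i\<close> belongs to the vertex \<open>vs ! i\<close>.\<close>

definition degree_matrix :: "'a set set \<Rightarrow> ('a \<times> 'a) set \<Rightarrow> 'a list \<Rightarrow> complex mat" where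
  "degree_matrix E A vs = mat (length vs) (length vs)
     (\<lambda>(i, j). if i = j then of_nat (mixed_degree E A (vs ! i)) else 0)"

definition H_omega :: "'a set set \<Rightarrow> ('a \<times> 'a) set \<Rightarrow> 'a list \<Rightarrow> complex mat" where
  "H_omega E A vs = mat (length vs) (length vs)
     (\<lambda>(i, j). if (vs ! i, vs ! j) \<in> A then omega
        else if (vs ! j, vs ! i) \<in> A then cnj omega
        else if {vs ! i, vs ! j} \<in> E then 1
        else 0)"

definition A_alpha :: "'a set set \<Rightarrow> ('a \<times> 'a) set \<Rightarrow> 'a list \<Rightarrow> real \<Rightarrow> complex mat" where
  "A_alpha E A vs \<alpha> =
     complex_of_real \<alpha> \<cdot>\<^sub>m degree_matrix E A vs + complex_of_real (1 - \<alpha>) \<cdot>\<^sub>m H_omega E A vs"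

text \<open>The list of eigenvalues, with algebraic multiplicity and in decreasing order, of a matrix
  all of whose eigenvalues are real. For Hermitian matrices the use of \<^const>\<open>Re\<close> loses nothing,
  see \<open>hermitian_eigenvalues_real\<close> and \<open>mset_real_eigenvalues\<close> below.\<close>

definition real_eigenvalues :: "complex mat \<Rightarrow> real list" where
  "real_eigenvalues M = rev (sorted_list_of_multiset (image_mset Re (proots (char_poly M))))"

text \<open>\<open>mu k M\<close> is the \<open>k\<close>-th largest eigenvalue, counted from \<open>k = 1\<close>.\<close>

definition mu :: "nat \<Rightarrow> complex mat \<Rightarrow> real" where
  "mu k M = real_eigenvalues M ! (k - 1)"

lemma A_alpha_carrier: "A_alpha E A vs \<alpha> \<in> carrier_mat (length vs) (length vs)"
  by (simp add: A_alpha_def degree_matrix_def H_omega_def)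

lemma (in mixed_graph) A_alpha_hermitian:
  assumes "i < length vs" "j < length vs"
  shows "A_alpha E A vs \<alpha> $$ (j, i) = cnj (A_alpha E A vs \<alpha> $$ (i, j))"
  using assms no_opposite_arcs
  by (auto simp: A_alpha_def degree_matrix_def H_omega_def insert_commute)

lemma hermitian_eigenvalues_real:
  assumes M: "M \<in> carrier_mat n n"
    and herm: "\<And>i j. i < n \<Longrightarrow> j < n \<Longrightarrow> M $$ (j, i) = cnj (M $$ (i, j))"
    and ev: "eigenvalue M k"
  shows "k \<in> \<real>"
proof -
  from ev M obtain x where x: "x \<in> carrier_vec n" "x \<noteq> 0\<^sub>v n" and eq: "M *\<^sub>v x = k \<cdot>\<^sub>v x"
    by (auto simp: eigenvalue_def eigenvector_def)
  define S where "S = (\<Sum>i<n. cnj (x $ i) * x $ i)"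
  define Q where "Q = (\<Sum>i<n. \<Sum>j<n. cnj (x $ i) * M $$ (i, j) * x $ j)"
  have row: "(\<Sum>j<n. M $$ (i, j) * x $ j) = k * x $ i" if "i < n" for i
  proof -
    have "(M *\<^sub>v x) $ i = (\<Sum>j<n. M $$ (i, j) * x $ j)"
      using that M x by (simp add: scalar_prod_def lessThan_atLeast0)
    then show ?thesis using eq that x by simp
  qed
  have "Q = (\<Sum>i<n. cnj (x $ i) * (\<Sum>j<n. M $$ (i, j) * x $ j))"
    by (simp add: Q_def sum_distrib_left mult.assoc)
  also have "\<dots> = (\<Sum>i<n. cnj (x $ i) * (k * x $ i))"
    by (intro sum.cong) (simp_all add: row)
  also have "\<dots> = k * S"
    by (simp add: S_def sum_distrib_left mult_ac)
  finally have QS: "Q = k * S" .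
  have "cnj Q = (\<Sum>i<n. \<Sum>j<n. cnj (x $ j) * M $$ (j, i) * x $ i)"
    unfolding Q_def cnj_sum
    by (intro sum.cong refl) (simp add: herm[symmetric] mult_ac)
  also have "\<dots> = Q"
    unfolding Q_def by (rule sum.swap)
  finally have cQ: "cnj Q = Q" .
  have S: "S = complex_of_real (\<Sum>i<n. (cmod (x $ i))\<^sup>2)"
    unfolding S_def of_real_sum complex_norm_square by (simp add: mult.commute)
  have "\<exists>i<n. x $ i \<noteq> 0"
    using x by (metis carrier_vecD eq_vecI index_zero_vec)
  then have "(\<Sum>i<n. (cmod (x $ i))\<^sup>2) > 0"
    by (auto intro: sum_pos2)
  then have "S \<noteq> 0" "cnj S = S"
    unfolding S of_real_eq_0_iff complex_cnj_complex_of_real by linarith simp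
  with cQ QS have "cnj k = k" by simp
  then show ?thesis by (simp add: Reals_cnj_iff)
qed

lemma length_real_eigenvalues:
  assumes "M \<in> carrier_mat n n"
  shows "length (real_eigenvalues M) = n"
  using degree_monic_char_poly[OF assms]
  by (simp add: real_eigenvalues_def size_proots_complex flip: size_mset)

lemma sorted_real_eigenvalues: "sorted_wrt (\<ge>) (real_eigenvalues M)"
  by (simp add: real_eigenvalues_def sorted_wrt_rev)

lemma mset_real_eigenvalues:
  assumes M: "M \<in> carrier_mat n n"
    and herm: "\<And>i j. i < n \<Longrightarrow> j < n \<Longrightarrow> M $$ (j, i) = cnj (M $$ (i, j))"
  shows "image_mset complex_of_real (mset (real_eigenvalues M)) = proots (char_poly M)"
proof -
  have "char_poly M \<noteq> 0" using degree_monic_char_poly[OF M] by auto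
  then have "complex_of_real (Re z) = z" if "z \<in># proots (char_poly M)" for z
    using that hermitian_eigenvalues_real[OF M herm] eigenvalue_root_char_poly[OF M]
    by (auto simp: of_real_Re)
  then have "image_mset (\<lambda>z. complex_of_real (Re z)) (proots (char_poly M))
      = image_mset (\<lambda>z. z) (proots (char_poly M))"
    by (intro image_mset_cong) auto
  then show ?thesis
    by (simp add: real_eigenvalues_def image_mset.compositionality o_def)
qed

end

theory Submission
  imports Defs
begin

text \<open>Every nonzero entry of \<open>H\<^sup>\<omega>\<close> is one of \<open>1\<close>, \<open>\<omega>\<close>, \<open>cnj \<omega>\<close>, so it has modulus \<open>1\<close> and
  lies in the sector of arguments at most \<open>\<pi>/3\<close>, where the real part is at least half the modulus.
  As degrees are nonnegative, \<open>\<bar>m\<bar> \<le> 2 Re m\<close> holds for every entry \<open>m\<close> of \<open>M = A\<^sub>\<alpha>\<close>.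
  Let \<open>x\<close> be an eigenvector for an eigenvalue \<open>\<lambda>\<close> with \<open>\<bar>\<lambda>\<bar> = \<rho>\<close>, and let \<open>y\<close> be the vector of the
  moduli of the entries of \<open>x\<close>. Then, by the triangle inequality,
  \<open>\<rho> \<bar>x\<bar>\<^sup>2 = \<bar>x* M x\<bar> \<le> 2 y* M y \<le> 2 \<mu>\<^sub>1 \<bar>y\<bar>\<^sup>2 = 2 \<mu>\<^sub>1 \<bar>x\<bar>\<^sup>2\<close>,
  which is the lower bound on \<open>\<mu>\<^sub>1\<close> (lemma \<open>spectral_radius_le_mu_1\<close>). The upper bound holds because
  \<open>\<mu>\<^sub>1\<close> is itself an eigenvalue.

  The step \<open>y* M y \<le> \<mu>\<^sub>1 \<bar>y\<bar>\<^sup>2\<close> is the Rayleigh bound. It follows from lemma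
  \<open>hermitian_rayleigh_eigenvalue\<close>: the least \<open>t\<close> for which \<open>t I - M\<close> is positive semidefinite is an
  eigenvalue of \<open>M\<close>. Indeed, an invertible positive semidefinite matrix \<open>B\<close> dominates a positive
  multiple of the identity, so if \<open>t I - M\<close> were invertible, \<open>t\<close> could be decreased.\<close>

section \<open>Quadratic forms of complex matrices\<close>

abbreviation norm_sq :: "complex vec \<Rightarrow> real" where
  "norm_sq x \<equiv> Re (x \<bullet>c x)"

abbreviation quad_form :: "complex mat \<Rightarrow> complex vec \<Rightarrow> real" where
  "quad_form M x \<equiv> Re ((M *\<^sub>v x) \<bullet>c x)"

lemma cscalar_prod_sum:
  assumes "x \<in> carrier_vec n" "y \<in> carrier_vec n"
  shows "x \<bullet>c y = (\<Sum>i<n. x $ i * cnj (y $ i))"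
  using assms by (simp add: scalar_prod_def lessThan_atLeast0)

lemma mult_mat_vec_sum:
  assumes "M \<in> carrier_mat n n" "x \<in> carrier_vec n" "i < n"
  shows "(M *\<^sub>v x) $ i = (\<Sum>j<n. M $$ (i, j) * x $ j)"
  using assms by (simp add: scalar_prod_def lessThan_atLeast0)

lemma cscalar_prod_mat_sum:
  assumes "M \<in> carrier_mat n n" "x \<in> carrier_vec n" "y \<in> carrier_vec n"
  shows "(M *\<^sub>v x) \<bullet>c y = (\<Sum>i<n. \<Sum>j<n. M $$ (i, j) * x $ j * cnj (y $ i))"
proof -
  have "M *\<^sub>v x \<in> carrier_vec n" using assms by simp
  then have "(M *\<^sub>v x) \<bullet>c y = (\<Sum>i<n. (M *\<^sub>v x) $ i * cnj (y $ i))"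
    using assms(3) by (rule cscalar_prod_sum)
  also have "\<dots> = (\<Sum>i<n. \<Sum>j<n. M $$ (i, j) * x $ j * cnj (y $ i))"
    by (intro sum.cong refl)
      (simp add: mult_mat_vec_sum[OF assms(1,2)] sum_distrib_right del: index_mult_mat_vec)
  finally show ?thesis .
qed

lemma cscalar_prod_self:
  assumes "x \<in> carrier_vec n"
  shows "x \<bullet>c x = complex_of_real (\<Sum>i<n. (cmod (x $ i))\<^sup>2)"
  by (simp only: cscalar_prod_sum[OF assms assms] complex_norm_square of_real_sum)

lemma norm_sq_sum:
  assumes "x \<in> carrier_vec n"
  shows "norm_sq x = (\<Sum>i<n. (cmod (x $ i))\<^sup>2)"
  by (simp add: cscalar_prod_self[OF assms] del: of_real_sum of_real_power)

lemma norm_sq_nonneg: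
  assumes "x \<in> carrier_vec n"
  shows "0 \<le> norm_sq x"
  by (simp only: norm_sq_sum[OF assms]) (simp add: sum_nonneg)

lemma norm_sq_pos:
  assumes "x \<in> carrier_vec n" "x \<noteq> 0\<^sub>v n"
  shows "0 < norm_sq x"
proof -
  have "\<exists>i<n. x $ i \<noteq> 0"
    using assms by (metis carrier_vecD eq_vecI index_zero_vec)
  then have "(\<Sum>i<n. (cmod (x $ i))\<^sup>2) > 0"
    by (auto intro: sum_pos2)
  then show ?thesis by (simp only: norm_sq_sum[OF assms(1)])
qed

lemma hermitian_cscalar_prod:
  assumes M: "M \<in> carrier_mat n n"
    and herm: "\<And>i j. i < n \<Longrightarrow> j < n \<Longrightarrow> M $$ (j, i) = cnj (M $$ (i, j))"
    and x: "x \<in> carrier_vec n" and y: "y \<in> carrier_vec n"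
  shows "(M *\<^sub>v x) \<bullet>c y = x \<bullet>c (M *\<^sub>v y)"
proof -
  have My: "M *\<^sub>v y \<in> carrier_vec n" using M y by simp
  have "(M *\<^sub>v x) \<bullet>c y = (\<Sum>j<n. \<Sum>i<n. M $$ (i, j) * x $ j * cnj (y $ i))"
    by (simp only: cscalar_prod_mat_sum[OF M x y]) (rule sum.swap)
  also have "\<dots> = (\<Sum>j<n. x $ j * cnj (\<Sum>i<n. M $$ (j, i) * y $ i))"
    unfolding cnj_sum sum_distrib_left
    by (intro sum.cong refl) (simp add: herm[symmetric] mult_ac)
  also have "\<dots> = (\<Sum>j<n. x $ j * cnj ((M *\<^sub>v y) $ j))"
    by (intro sum.cong refl) (simp add: mult_mat_vec_sum[OF M y] del: index_mult_mat_vec)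
  also have "\<dots> = x \<bullet>c (M *\<^sub>v y)"
    using cscalar_prod_sum[OF x My] by simp
  finally show ?thesis .
qed

lemma norm_sq_mult_mat_vec_bound:
  assumes M: "M \<in> carrier_mat n n"
  shows "\<exists>L>0. \<forall>x\<in>carrier_vec n. norm_sq (M *\<^sub>v x) \<le> L * norm_sq x"
proof (intro exI conjI ballI)
  let ?L = "(\<Sum>i<n. (\<Sum>j<n. cmod (M $$ (i, j)))\<^sup>2) + 1"
  show "0 < ?L" by (simp add: add_nonneg_pos sum_nonneg)
  fix x :: "complex vec" assume x: "x \<in> carrier_vec n"
  have Mx: "M *\<^sub>v x \<in> carrier_vec n" using M x by simp
  have entry: "cmod (x $ j) \<le> sqrt (norm_sq x)" if "j < n" for j
  proof (rule real_le_rsqrt)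
    show "(cmod (x $ j))\<^sup>2 \<le> norm_sq x"
      unfolding norm_sq_sum[OF x] using that
      by (intro member_le_sum[of j "{..<n}" "\<lambda>j. (cmod (x $ j))\<^sup>2"]) auto
  qed
  have row: "(cmod ((M *\<^sub>v x) $ i))\<^sup>2 \<le> (\<Sum>j<n. cmod (M $$ (i, j)))\<^sup>2 * norm_sq x"
    if "i < n" for i
  proof -
    have "cmod ((M *\<^sub>v x) $ i) \<le> (\<Sum>j<n. cmod (M $$ (i, j) * x $ j))"
      unfolding mult_mat_vec_sum[OF M x that] by (rule norm_sum)
    also have "\<dots> \<le> (\<Sum>j<n. cmod (M $$ (i, j)) * sqrt (norm_sq x))"
      by (intro sum_mono) (simp add: norm_mult mult_left_mono entry)
    also have "\<dots> = (\<Sum>j<n. cmod (M $$ (i, j))) * sqrt (norm_sq x)"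
      by (simp add: sum_distrib_right)
    finally have "(cmod ((M *\<^sub>v x) $ i))\<^sup>2
        \<le> ((\<Sum>j<n. cmod (M $$ (i, j))) * sqrt (norm_sq x))\<^sup>2"
      by (intro power_mono) auto
    then show ?thesis by (simp add: power_mult_distrib norm_sq_nonneg[OF x])
  qed
  have "norm_sq (M *\<^sub>v x) \<le> (\<Sum>i<n. (\<Sum>j<n. cmod (M $$ (i, j)))\<^sup>2 * norm_sq x)"
    unfolding norm_sq_sum[OF Mx] by (intro sum_mono row) simp
  also have "\<dots> \<le> ?L * norm_sq x"
    by (simp add: sum_distrib_right[symmetric] distrib_right norm_sq_nonneg[OF x])
  finally show "norm_sq (M *\<^sub>v x) \<le> ?L * norm_sq x" .
qed

lemma quad_form_le_norm_sq:
  assumes M: "M \<in> carrier_mat n n" and x: "x \<in> carrier_vec n"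
  shows "quad_form M x \<le> norm_sq (M *\<^sub>v x) + norm_sq x"
proof -
  have Mx: "M *\<^sub>v x \<in> carrier_vec n" using M x by simp
  have pointwise: "Re (a * cnj b) \<le> (cmod a)\<^sup>2 + (cmod b)\<^sup>2" for a b
  proof -
    have "Re (a * cnj b) \<le> cmod a * cmod b"
      using complex_Re_le_cmod[of "a * cnj b"] by (simp add: norm_mult)
    also have "\<dots> \<le> (cmod a)\<^sup>2 + (cmod b)\<^sup>2"
      using sum_squares_bound[of "cmod a" "cmod b"] mult_nonneg_nonneg[of "cmod a" "cmod b"]
        norm_ge_zero[of a] norm_ge_zero[of b] by linarith
    finally show ?thesis .
  qed
  have "quad_form M x = (\<Sum>i<n. Re ((M *\<^sub>v x) $ i * cnj (x $ i)))"
    by (simp only: cscalar_prod_sum[OF Mx x] Re_sum)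
  also have "\<dots> \<le> (\<Sum>i<n. (cmod ((M *\<^sub>v x) $ i))\<^sup>2 + (cmod (x $ i))\<^sup>2)"
    by (intro sum_mono pointwise)
  also have "\<dots> = norm_sq (M *\<^sub>v x) + norm_sq x"
    by (simp only: norm_sq_sum[OF Mx] norm_sq_sum[OF x] sum.distrib)
  finally show ?thesis .
qed

lemma quad_form_bound:
  assumes M: "M \<in> carrier_mat n n"
  shows "\<exists>L>0. \<forall>x\<in>carrier_vec n. quad_form M x \<le> L * norm_sq x"
proof -
  obtain L where "L > 0" and L: "\<And>x. x \<in> carrier_vec n \<Longrightarrow> norm_sq (M *\<^sub>v x) \<le> L * norm_sq x"
    using norm_sq_mult_mat_vec_bound[OF M] by blast
  have "quad_form M x \<le> (L + 1) * norm_sq x" if "x \<in> carrier_vec n" for x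
    using quad_form_le_norm_sq[OF M that] L[OF that] by (simp add: distrib_right)
  with \<open>L > 0\<close> show ?thesis by (intro exI[of _ "L + 1"]) auto
qed

section \<open>The Rayleigh bound\<close>

text \<open>A substitute for the Cauchy-Schwarz inequality of the form of \<open>M\<close>. For real \<open>s\<close>, the form at
  \<open>x - s M x\<close> is nonnegative and at most \<open>x* M x - 2 s \<bar>M x\<bar>\<^sup>2 + s\<^sup>2 L \<bar>M x\<bar>\<^sup>2\<close>; the choice
  \<open>s = 1/L\<close> minimises this bound.\<close>

lemma psd_norm_sq_le_quad_form:
  assumes M: "M \<in> carrier_mat n n"
    and herm: "\<And>i j. i < n \<Longrightarrow> j < n \<Longrightarrow> M $$ (j, i) = cnj (M $$ (i, j))"
    and psd: "\<And>x. x \<in> carrier_vec n \<Longrightarrow> 0 \<le> quad_form M x"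
    and L: "0 < L" "\<And>x. x \<in> carrier_vec n \<Longrightarrow> quad_form M x \<le> L * norm_sq x"
    and x: "x \<in> carrier_vec n"
  shows "norm_sq (M *\<^sub>v x) \<le> L * quad_form M x"
proof -
  define s where "s = 1 / L"
  define w where "w = M *\<^sub>v x"
  have w: "w \<in> carrier_vec n" and Mw: "M *\<^sub>v w \<in> carrier_vec n"
    using M x by (auto simp: w_def)
  define c where "c = - complex_of_real s"
  have cw: "c \<cdot>\<^sub>v w \<in> carrier_vec n" using w by simp
  have M_line: "M *\<^sub>v (x + c \<cdot>\<^sub>v w) = w + c \<cdot>\<^sub>v (M *\<^sub>v w)"
    using mult_add_distrib_mat_vec[OF M x cw] mult_mat_vec[OF M w, of c]
    by (simp add: w_def[symmetric])
  have conj_line: "conjugate (x + c \<cdot>\<^sub>v w) = conjugate x + c \<cdot>\<^sub>v conjugate w"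
    using x w by (intro eq_vecI) (auto simp: c_def)
  have "(M *\<^sub>v (x + c \<cdot>\<^sub>v w)) \<bullet>c (x + c \<cdot>\<^sub>v w)
      = w \<bullet>c x + c * (w \<bullet>c w) + c * ((M *\<^sub>v w) \<bullet>c x) + c * c * ((M *\<^sub>v w) \<bullet>c w)"
    unfolding M_line conj_line using x w Mw
    by (simp add: add_scalar_prod_distrib[of _ n] scalar_prod_add_distrib[of _ n] algebra_simps)
  also have "(M *\<^sub>v w) \<bullet>c x = w \<bullet>c w"
    using hermitian_cscalar_prod[OF M herm w x] by (simp add: w_def)
  finally have "quad_form M (x + c \<cdot>\<^sub>v w)
      = quad_form M x - 2 * s * norm_sq w + s * s * quad_form M w"
    by (simp add: c_def w_def)
  moreover have "0 \<le> quad_form M (x + c \<cdot>\<^sub>v w)"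
    using x cw by (intro psd) simp
  moreover have "s * s * quad_form M w \<le> s * s * (L * norm_sq w)"
    using L w by (intro mult_left_mono) auto
  moreover have "s * s * (L * norm_sq w) = s * norm_sq w"
    using L(1) by (simp add: s_def)
  ultimately have "s * norm_sq w \<le> quad_form M x" by simp
  then show ?thesis using L(1) by (simp add: s_def w_def field_simps)
qed

text \<open>With \<open>L\<close> as above and \<open>K\<close> a bound for the inverse of \<open>M\<close>,
  \<open>\<bar>x\<bar>\<^sup>2 \<le> K \<bar>M x\<bar>\<^sup>2 \<le> K L x* M x\<close>.\<close>

lemma psd_invertible_coercive:
  assumes M: "M \<in> carrier_mat n n"
    and herm: "\<And>i j. i < n \<Longrightarrow> j < n \<Longrightarrow> M $$ (j, i) = cnj (M $$ (i, j))"
    and psd: "\<And>x. x \<in> carrier_vec n \<Longrightarrow> 0 \<le> quad_form M x"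
    and det: "det M \<noteq> 0"
  shows "\<exists>\<epsilon>>0. \<forall>x\<in>carrier_vec n. \<epsilon> * norm_sq x \<le> quad_form M x"
proof -
  obtain C where C: "C \<in> carrier_mat n n" and CM: "C * M = 1\<^sub>m n"
    using det_non_zero_imp_unit[OF M det] by (auto simp: Units_def ring_mat_def)
  obtain L where L: "L > 0" "\<And>x. x \<in> carrier_vec n \<Longrightarrow> quad_form M x \<le> L * norm_sq x"
    using quad_form_bound[OF M] by blast
  obtain K where K: "K > 0" "\<And>x. x \<in> carrier_vec n \<Longrightarrow> norm_sq (C *\<^sub>v x) \<le> K * norm_sq x"
    using norm_sq_mult_mat_vec_bound[OF C] by blast
  have "1 / (K * L) * norm_sq x \<le> quad_form M x" if x: "x \<in> carrier_vec n" for x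
  proof -
    have Mx: "M *\<^sub>v x \<in> carrier_vec n" using M x by simp
    have "C *\<^sub>v (M *\<^sub>v x) = x"
      using assoc_mult_mat_vec[OF C M x] CM x by simp
    then have "norm_sq x \<le> K * norm_sq (M *\<^sub>v x)"
      using K(2)[OF Mx] by simp
    also have "\<dots> \<le> K * (L * quad_form M x)"
      using K(1) psd_norm_sq_le_quad_form[OF M herm psd L x] by (intro mult_left_mono) auto
    finally show ?thesis using K(1) L(1) by (simp add: field_simps)
  qed
  then show ?thesis using K(1) L(1) by (intro exI[of _ "1 / (K * L)"]) auto
qed

text \<open>The set \<open>S\<close> of all \<open>t\<close> with \<open>t I - M\<close> positive semidefinite contains its infimum \<open>t\<close>, because
  the defining inequalities are closed conditions. If \<open>B = t I - M\<close> were invertible, it would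
  dominate \<open>\<epsilon> I\<close> and \<open>t - \<epsilon>\<close> would lie in \<open>S\<close>. So \<open>B\<close> has a kernel vector, which is an
  eigenvector of \<open>M\<close>. Thus the supremum of the Rayleigh quotient is an eigenvalue, without an
  appeal to the compactness of the unit sphere or to diagonalisation.\<close>

lemma hermitian_rayleigh_eigenvalue:
  assumes M: "M \<in> carrier_mat n n" and n: "0 < n"
    and herm: "\<And>i j. i < n \<Longrightarrow> j < n \<Longrightarrow> M $$ (j, i) = cnj (M $$ (i, j))"
  shows "\<exists>t. eigenvalue M (complex_of_real t)
    \<and> (\<forall>x\<in>carrier_vec n. quad_form M x \<le> t * norm_sq x)"
proof -
  define S where "S = {t. \<forall>x\<in>carrier_vec n. quad_form M x \<le> t * norm_sq x}"
  define t where "t = Inf S"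
  have "S \<noteq> {}" using quad_form_bound[OF M] by (auto simp: S_def)
  have bdd: "bdd_below S"
  proof (rule bdd_belowI)
    fix s assume s: "s \<in> S"
    let ?e = "unit_vec n 0 :: complex vec"
    have e: "?e \<in> carrier_vec n" "?e \<noteq> 0\<^sub>v n" using n by auto
    show "quad_form M ?e / norm_sq ?e \<le> s"
      using s e(1) norm_sq_pos[OF e] by (auto simp: S_def divide_le_eq)
  qed
  have t: "quad_form M x \<le> t * norm_sq x" if x: "x \<in> carrier_vec n" for x
  proof (cases "x = 0\<^sub>v n")
    case True
    then show ?thesis using M by simp
  next
    case False
    then have pos: "0 < norm_sq x" using norm_sq_pos[OF x] by simp
    then have "quad_form M x / norm_sq x \<le> t"
      unfolding t_def using \<open>S \<noteq> {}\<close> x by (intro cInf_greatest) (auto simp: S_def divide_le_eq)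
    with pos show ?thesis by (simp add: divide_le_eq)
  qed
  define B where "B = complex_of_real t \<cdot>\<^sub>m 1\<^sub>m n - M"
  have B: "B \<in> carrier_mat n n" using M by (auto simp: B_def)
  have hermB: "B $$ (j, i) = cnj (B $$ (i, j))" if "i < n" "j < n" for i j
    using that M herm[OF that] by (simp add: B_def)
  have B_mult: "B *\<^sub>v x = complex_of_real t \<cdot>\<^sub>v x - M *\<^sub>v x" if x: "x \<in> carrier_vec n" for x
  proof -
    have "(complex_of_real t \<cdot>\<^sub>m 1\<^sub>m n) *\<^sub>v x = complex_of_real t \<cdot>\<^sub>v x"
      using x by (intro eq_vecI) auto
    then show ?thesis
      using minus_mult_distrib_mat_vec[of "complex_of_real t \<cdot>\<^sub>m 1\<^sub>m n" n n M x] M x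
      by (simp add: B_def)
  qed
  have formB: "quad_form B x = t * norm_sq x - quad_form M x" if x: "x \<in> carrier_vec n" for x
    using M x by (simp add: B_mult[OF x] minus_scalar_prod_distrib[of _ n])
  have "det B = 0"
  proof (rule ccontr)
    assume "det B \<noteq> 0"
    then obtain \<epsilon> where "\<epsilon> > 0"
      and \<epsilon>: "\<And>x. x \<in> carrier_vec n \<Longrightarrow> \<epsilon> * norm_sq x \<le> quad_form B x"
      using psd_invertible_coercive[OF B hermB] formB t by force
    then have "t - \<epsilon> \<in> S" using formB by (force simp: S_def algebra_simps)
    then have "t \<le> t - \<epsilon>" unfolding t_def by (rule cInf_lower[OF _ bdd])
    with \<open>\<epsilon> > 0\<close> show False by simp
  qed
  then obtain x where x: "x \<in> carrier_vec n" "x \<noteq> 0\<^sub>v n" and "B *\<^sub>v x = 0\<^sub>v n"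
    using det_0_iff_vec_prod_zero_field[OF B] by blast
  moreover have "B *\<^sub>v x = complex_of_real t \<cdot>\<^sub>v x - M *\<^sub>v x"
    using x(1) by (rule B_mult)
  ultimately have diff: "complex_of_real t \<cdot>\<^sub>v x - M *\<^sub>v x = 0\<^sub>v n" by simp
  have "M *\<^sub>v x = complex_of_real t \<cdot>\<^sub>v x"
  proof (rule eq_vecI)
    fix i assume "i < dim_vec (complex_of_real t \<cdot>\<^sub>v x)"
    then have i: "i < n" using x by simp
    then have "(complex_of_real t \<cdot>\<^sub>v x - M *\<^sub>v x) $ i = 0" using diff by simp
    then show "(M *\<^sub>v x) $ i = (complex_of_real t \<cdot>\<^sub>v x) $ i"
      using i M x by simp
  qed (use M x in simp)
  then have "eigenvalue M (complex_of_real t)"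
    using M x by (auto simp: eigenvalue_def eigenvector_def)
  with t show ?thesis by blast
qed

section \<open>The largest eigenvalue of a Hermitian matrix\<close>

lemma hermitian_eigenvalue_iff:
  assumes M: "M \<in> carrier_mat n n"
    and herm: "\<And>i j. i < n \<Longrightarrow> j < n \<Longrightarrow> M $$ (j, i) = cnj (M $$ (i, j))"
  shows "eigenvalue M (complex_of_real t) \<longleftrightarrow> t \<in> set (real_eigenvalues M)"
proof -
  have "char_poly M \<noteq> 0" using degree_monic_char_poly[OF M] by auto
  then have "eigenvalue M (complex_of_real t)
      \<longleftrightarrow> complex_of_real t \<in># proots (char_poly M)"
    using eigenvalue_root_char_poly[OF M] by simp
  also have "\<dots> \<longleftrightarrow> t \<in> set (real_eigenvalues M)"
    using mset_real_eigenvalues[OF M herm, symmetric] by auto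
  finally show ?thesis .
qed

lemma mu_1_eigenvalue:
  assumes M: "M \<in> carrier_mat n n" and n: "0 < n"
    and herm: "\<And>i j. i < n \<Longrightarrow> j < n \<Longrightarrow> M $$ (j, i) = cnj (M $$ (i, j))"
  shows "eigenvalue M (complex_of_real (mu 1 M))"
  using hermitian_eigenvalue_iff[OF M herm] length_real_eigenvalues[OF M] n
  by (simp add: mu_def)

lemma eigenvalue_le_mu_1:
  assumes M: "M \<in> carrier_mat n n"
    and herm: "\<And>i j. i < n \<Longrightarrow> j < n \<Longrightarrow> M $$ (j, i) = cnj (M $$ (i, j))"
    and ev: "eigenvalue M (complex_of_real t)"
  shows "t \<le> mu 1 M"
proof -
  have "t \<in> set (real_eigenvalues M)" using hermitian_eigenvalue_iff[OF M herm] ev by simp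
  then show ?thesis
    using sorted_real_eigenvalues[of M] by (cases "real_eigenvalues M") (auto simp: mu_def)
qed

lemma quad_form_le_mu_1:
  assumes M: "M \<in> carrier_mat n n" and n: "0 < n"
    and herm: "\<And>i j. i < n \<Longrightarrow> j < n \<Longrightarrow> M $$ (j, i) = cnj (M $$ (i, j))"
    and x: "x \<in> carrier_vec n"
  shows "quad_form M x \<le> mu 1 M * norm_sq x"
proof -
  obtain t where ev: "eigenvalue M (complex_of_real t)" and t: "quad_form M x \<le> t * norm_sq x"
    using hermitian_rayleigh_eigenvalue[OF M n herm] x by blast
  note t
  also have "t * norm_sq x \<le> mu 1 M * norm_sq x"
    using eigenvalue_le_mu_1[OF M herm ev] norm_sq_nonneg[OF x] by (rule mult_right_mono)
  finally show ?thesis .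
qed

lemma mu_1_le_spectral_radius:
  assumes M: "M \<in> carrier_mat n n" and n: "0 < n"
    and herm: "\<And>i j. i < n \<Longrightarrow> j < n \<Longrightarrow> M $$ (j, i) = cnj (M $$ (i, j))"
  shows "mu 1 M \<le> spectral_radius M"
proof -
  have "complex_of_real (mu 1 M) \<in> spectrum M"
    using mu_1_eigenvalue[OF M n herm] by (simp add: spectrum_def)
  then have "\<bar>mu 1 M\<bar> \<le> spectral_radius M"
    by (intro spectral_radius_mem_max(2)[OF M n]) (force intro: image_eqI)
  then show ?thesis by linarith
qed

text \<open>Replacing an eigenvector by the vector of its moduli loses at most the factor \<open>c\<close> in the
  quadratic form, whatever the sign of the eigenvalue.\<close>

lemma spectral_radius_le_mu_1:
  assumes M: "M \<in> carrier_mat n n" and n: "0 < n"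
    and herm: "\<And>i j. i < n \<Longrightarrow> j < n \<Longrightarrow> M $$ (j, i) = cnj (M $$ (i, j))"
    and c: "0 \<le> c"
    and sector: "\<And>i j. i < n \<Longrightarrow> j < n \<Longrightarrow> cmod (M $$ (i, j)) \<le> c * Re (M $$ (i, j))"
  shows "spectral_radius M \<le> c * mu 1 M"
proof -
  obtain k where ev: "eigenvalue M k" and k: "cmod k = spectral_radius M"
    using spectral_radius_mem_max(1)[OF M n] by (auto simp: spectrum_def)
  then obtain x where x: "x \<in> carrier_vec n" "x \<noteq> 0\<^sub>v n" and eq: "M *\<^sub>v x = k \<cdot>\<^sub>v x"
    using M by (auto simp: eigenvalue_def eigenvector_def)
  define y where "y = vec n (\<lambda>i. complex_of_real (cmod (x $ i)))"
  have y: "y \<in> carrier_vec n" by (simp add: y_def)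
  have norm_y: "norm_sq y = norm_sq x"
    unfolding norm_sq_sum[OF y] norm_sq_sum[OF x(1)] by (simp add: y_def)
  have "(M *\<^sub>v x) \<bullet>c x = k * (x \<bullet>c x)" using x by (simp add: eq)
  then have "spectral_radius M * norm_sq x = cmod ((M *\<^sub>v x) \<bullet>c x)"
    using norm_sq_nonneg[OF x(1)]
    by (simp add: norm_mult k cscalar_prod_self[OF x(1)] del: of_real_sum of_real_power)
  also have "\<dots> \<le> (\<Sum>i<n. \<Sum>j<n. cmod (M $$ (i, j) * x $ j * cnj (x $ i)))"
    unfolding cscalar_prod_mat_sum[OF M x(1) x(1)] by (intro sum_norm_le norm_sum)
  also have "\<dots> \<le> (\<Sum>i<n. \<Sum>j<n. c * Re (M $$ (i, j) * y $ j * cnj (y $ i)))"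
  proof (intro sum_mono)
    fix i j assume "i \<in> {..<n}" "j \<in> {..<n}"
    then have ij: "i < n" "j < n" by auto
    have "cmod (M $$ (i, j)) * (cmod (x $ j) * cmod (x $ i))
        \<le> c * Re (M $$ (i, j)) * (cmod (x $ j) * cmod (x $ i))"
      using sector[OF ij] by (intro mult_right_mono) auto
    then show "cmod (M $$ (i, j) * x $ j * cnj (x $ i))
        \<le> c * Re (M $$ (i, j) * y $ j * cnj (y $ i))"
      using ij by (simp add: y_def norm_mult mult_ac)
  qed
  also have "\<dots> = c * quad_form M y"
    by (simp only: cscalar_prod_mat_sum[OF M y y] Re_sum sum_distrib_left)
  also have "\<dots> \<le> c * (mu 1 M * norm_sq y)"
    using quad_form_le_mu_1[OF M n herm y] c by (rule mult_left_mono)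
  also have "\<dots> = (c * mu 1 M) * norm_sq x" by (simp add: norm_y)
  finally show ?thesis using norm_sq_pos[OF x] by simp
qed

section \<open>Mixed graphs\<close>

lemma Re_omega: "Re omega = 1 / 2"
  by (simp add: omega_def)

lemma cmod_omega: "cmod omega = 1"
  by (simp add: omega_def cmod_def power_divide)

lemma A_alpha_entry_sector:
  assumes \<alpha>: "0 \<le> \<alpha>" "\<alpha> \<le> 1" and ij: "i < length vs" "j < length vs"
  shows "cmod (A_alpha E A vs \<alpha> $$ (i, j)) \<le> 2 * Re (A_alpha E A vs \<alpha> $$ (i, j))"
proof -
  define d where "d = (if i = j then real (mixed_degree E A (vs ! i)) else 0)"
  define h where "h = H_omega E A vs $$ (i, j)"
  have entry: "A_alpha E A vs \<alpha> $$ (i, j)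
      = complex_of_real (\<alpha> * d) + complex_of_real (1 - \<alpha>) * h"
    using ij by (simp add: A_alpha_def degree_matrix_def d_def h_def H_omega_def)
  have h: "cmod h \<le> 2 * Re h"
    using ij by (simp add: h_def H_omega_def Re_omega cmod_omega)
  have d: "0 \<le> d" "0 \<le> \<alpha> * d" using \<alpha> by (simp_all add: d_def)
  have "cmod (A_alpha E A vs \<alpha> $$ (i, j))
      \<le> cmod (complex_of_real (\<alpha> * d)) + cmod (complex_of_real (1 - \<alpha>) * h)"
    unfolding entry by (rule norm_triangle_ineq)
  also have "\<dots> = \<alpha> * d + (1 - \<alpha>) * cmod h"
    using d \<alpha> by (simp add: norm_mult abs_mult del: of_real_mult of_real_diff)
  also have "\<dots> \<le> 2 * (\<alpha> * d) + (1 - \<alpha>) * (2 * Re h)"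
    using d \<alpha> h by (intro add_mono mult_left_mono) auto
  also have "\<dots> = 2 * Re (A_alpha E A vs \<alpha> $$ (i, j))"
    by (simp add: entry algebra_simps)
  finally show ?thesis .
qed

theorem theorem3p3:
  fixes V :: "'a set" and E :: "'a set set" and A :: "('a \<times> 'a) set"
    and vs :: "'a list" and n :: nat and \<alpha> :: real
  assumes "mixed_graph V E A"
    and "card V = n" and "n \<ge> 1"
    and "distinct vs" and "set vs = V"
    and "0 \<le> \<alpha>" and "\<alpha> \<le> 1"
  shows "1 / 2 * spectral_radius (A_alpha E A vs \<alpha>) \<le> mu 1 (A_alpha E A vs \<alpha>)
    \<and> mu 1 (A_alpha E A vs \<alpha>) \<le> spectral_radius (A_alpha E A vs \<alpha>)"
proof -
  let ?M = "A_alpha E A vs \<alpha>"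
  have M: "?M \<in> carrier_mat (length vs) (length vs)" by (rule A_alpha_carrier)
  have n: "0 < length vs" using assms(2,3) distinct_card[OF assms(4)] unfolding assms(5) by linarith
  have herm: "?M $$ (j, i) = cnj (?M $$ (i, j))" if "i < length vs" "j < length vs" for i j
    using mixed_graph.A_alpha_hermitian[OF assms(1) that] .
  have "spectral_radius ?M \<le> 2 * mu 1 ?M"
    using spectral_radius_le_mu_1[OF M n herm _ A_alpha_entry_sector[OF assms(6,7)]] by simp
  then show ?thesis using mu_1_le_spectral_radius[OF M n herm] by simp
qed

end
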